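(* Let $N,K,L$ be positive integers with $L\le K$, let $w\in\{1,\dots,\lfloor K/L\rfloor\}$ and $M=wN/K$. Define $$R_{\text{new}}(M)=\frac{\sum_{\mathbf b\in\mathcal B}\min\{2(K-wL)+w-1-\widehat{\mathbf b},\;K\}}{|\hat{\mathcal S}|\,(w+1)},\qquad R_{\text{HKD}}(M)=\frac{K-wL}{1+w},\qquad R_{\text{RK}}(M)=K\Big(1-\frac{LM}{N}\Big)^2,$$ where $\mathcal B$ is the set of all weak $(w+1)$-compositions of $K-wL-1$, $\widehat{\mathbf b}$ is the maximum component of $\mathbf b$, and $\hat{\mathcal S}$ is the collection of all subsets $s\subseteq\{1,\dots,K\}$ with $|s|=w$ such that (if $w>1$) any two distinct $a,a'\in s$ satisfy $|a-a'|\ge L$ and $K-|a-a'|\ge L$. Then $$R_{\text{new}}(M)\le R_{\text{HKD}}(M)\quad\text{and}\quad R_{\text{new}}(M)\le R_{\text{RK}}(M).$$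
   Context: A weak $m$-composition of an integer $n$ is a vector $(b_m,\dots,b_1)$ of $m$ non-negative integers with sum $n$ (there are none if $n<0$, in which case the sum over $\mathcal B$ is $0$). The cardinality of $\hat{\mathcal S}$ is $|\hat{\mathcal S}|=\frac{K}{w}\binom{K-wL+w-1}{w-1}$. (These quantities are achievable server transmission rates of the multi-access coded caching problem with $N$ files, $K$ caches of size $M$ and $K$ users each accessing $L$ consecutive caches.) *)

theory Defs
  imports Complex_Main
begin

text \<open>A vector is a list of length \<open>m\<close>. The target \<open>n\<close> is an
  integer, so that there are no compositions of a negative number (truncated subtraction on
  \<^typ>\<open>nat\<close> would yield the zero vector instead).\<close>

definition weak_compositions :: "nat \<Rightarrow> int \<Rightarrow> nat list set" where
  "weak_compositions m n = {b. length b = m \<and> int (sum_list b) = n}"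

definition max_component :: "nat list \<Rightarrow> nat" where
  "max_component b = Max (set b)"

definition S_hat :: "nat \<Rightarrow> nat \<Rightarrow> nat \<Rightarrow> nat set set" where
  "S_hat K L w = {s. s \<subseteq> {1..K} \<and> card s = w \<and>
     (w > 1 \<longrightarrow> (\<forall>a\<in>s. \<forall>a'\<in>s. a \<noteq> a' \<longrightarrow>
        \<bar>int a - int a'\<bar> \<ge> int L \<and> int K - \<bar>int a - int a'\<bar> \<ge> int L))}"

text \<open>The first two rates depend on the memory size \<open>M = w N / K\<close> only through \<open>w\<close>.\<close>

definition R_new :: "nat \<Rightarrow> nat \<Rightarrow> nat \<Rightarrow> real" where
  "R_new K L w =
     (\<Sum>b\<in>weak_compositions (w + 1) (int K - int w * int L - 1).
        real_of_int (min (2 * (int K - int w * int L) + int w - 1 - int (max_component b)) (int K)))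
     / (real (card (S_hat K L w)) * (real w + 1))"

definition R_HKD :: "nat \<Rightarrow> nat \<Rightarrow> nat \<Rightarrow> real" where
  "R_HKD K L w = (real K - real w * real L) / (1 + real w)"

definition R_RK :: "nat \<Rightarrow> nat \<Rightarrow> nat \<Rightarrow> real \<Rightarrow> real" where
  "R_RK N K L M = real K * (1 - real L * M / real N)\<^sup>2"

end

theory Submission
  imports Defs
begin

text \<open>Put \<open>D = K - wL\<close>. The key fact is \<open>K |\<B>| \<le> D |\<S>|\<close>, so that
  \<open>R\<^sub>n\<^sub>e\<^sub>w \<le> c D / (K (w + 1))\<close> whenever every summand is at most \<open>c\<close>. Taking \<open>c = K\<close> gives
  the bound by \<open>R\<^sub>H\<^sub>K\<^sub>D\<close>, and \<open>c = D (w + 1)\<close> the bound by \<open>R\<^sub>R\<^sub>K = D\<^sup>2 / K\<close>.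

  For the key fact only a lower bound on \<open>|\<S>|\<close> is needed: double counting of the pairs
  \<open>a \<in> s \<in> \<S>\<close>, together with the rotations of the circle, reduces it to counting \<open>L\<close>-spaced
  \<open>(w - 1)\<close>-subsets of an interval.\<close>

section \<open>Counting spaced subsets of an interval\<close>

text \<open>Each point \<open>x\<close> stands for the block \<open>{x..<x + L}\<close>; the blocks are disjoint and fit
  into \<open>{..<n}\<close>.\<close>

definition spaced_sets :: "nat \<Rightarrow> nat \<Rightarrow> nat \<Rightarrow> nat set set" where
  "spaced_sets L k n = {t. finite t \<and> card t = k \<and> (\<forall>x\<in>t. x + L \<le> n) \<and>
     (\<forall>x\<in>t. \<forall>y\<in>t. x < y \<longrightarrow> x + L \<le> y)}"

lemma finite_spaced_sets: "finite (spaced_sets L k n)"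
proof (rule finite_subset)
  show "spaced_sets L k n \<subseteq> Pow {..n}"
    by (auto simp: spaced_sets_def)
qed simp

text \<open>Contracting every block to a single cell turns the interval into \<open>m\<close> cells
  with \<open>k\<close> of them marked. The induction is Pascal's rule: either the last cell of the
  interval is left free, or it ends the last block.\<close>

lemma binomial_le_card_spaced_sets:
  assumes "L > 0"
  shows "m choose k \<le> card (spaced_sets L k (m + k * (L - 1)))"
proof (induction m arbitrary: k)
  case 0
  have "spaced_sets L 0 0 = {{}}"
    by (auto simp: spaced_sets_def)
  then show ?case
    by (cases k) auto
next
  case (Suc m)
  show ?case
  proof (cases k)
    case 0
    have "{} \<in> spaced_sets L 0 (Suc m)"
      by (simp add: spaced_sets_def)
    then have "card (spaced_sets L 0 (Suc m)) > 0"
      using finite_spaced_sets card_gt_0_iff by blast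
    then show ?thesis
      using 0 by simp
  next
    case k: (Suc j)
    \<comment> \<open>A block starting at \<open>p\<close> ends exactly at the right end of the
      interval of \<open>?C\<close>, which leaves \<open>{..<p}\<close> for the other
      \<open>j\<close> blocks.\<close>
    define p where "p = m + j * (L - 1)"
    let ?A = "spaced_sets L k (m + k * (L - 1))"
    let ?B = "spaced_sets L j p"
    let ?C = "spaced_sets L k (Suc m + k * (L - 1))"
    have end_k: "m + k * (L - 1) = p + (L - 1)"
      by (simp add: k p_def)
    have B_less: "x < p" if "t \<in> ?B" "x \<in> t" for t x
      using that assms by (force simp: spaced_sets_def)
    \<comment> \<open>The interval of \<open>?A\<close> is one cell too short for a block starting
      at \<open>p\<close>, so no member of \<open>?A\<close> contains \<open>p\<close>.\<close>
    have A_less: "x < p" if "t \<in> ?A" "x \<in> t" for t x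
      using that assms unfolding end_k by (force simp: spaced_sets_def)
    have "inj_on (insert p) ?B"
      using B_less by (metis inj_onI insert_ident less_irrefl)
    then have card_B: "card (insert p ` ?B) = card ?B"
      by (rule card_image)
    have disj: "?A \<inter> insert p ` ?B = {}"
      using A_less by blast
    have "?A \<subseteq> ?C"
      by (force simp: spaced_sets_def)
    moreover have "insert p ` ?B \<subseteq> ?C"
    proof (rule image_subsetI)
      fix t assume t: "t \<in> ?B"
      have t': "finite t" "card t = j" "\<And>x. x \<in> t \<Longrightarrow> x + L \<le> p"
          "\<And>x y. x \<in> t \<Longrightarrow> y \<in> t \<Longrightarrow> x < y \<Longrightarrow> x + L \<le> y"
        using t by (simp_all add: spaced_sets_def)
      have "p \<notin> t"
        using B_less[OF t] by blast
      then have "card (insert p t) = k"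
        using t' by (simp add: k)
      moreover have "x + L \<le> Suc m + k * (L - 1)" if "x \<in> insert p t" for x
        using that t'(3)[of x] assms end_k by auto
      moreover have "x + L \<le> y" if "x \<in> insert p t" "y \<in> insert p t" "x < y" for x y
        using that t'(3)[of x] t'(4)[of x y] B_less[OF t, of y] by auto
      ultimately show "insert p t \<in> ?C"
        using t'(1) by (simp add: spaced_sets_def)
    qed
    ultimately have "card (?A \<union> insert p ` ?B) \<le> card ?C"
      by (intro card_mono finite_spaced_sets) auto
    then have "card ?A + card ?B \<le> card ?C"
      using disj card_B by (simp add: card_Un_disjoint finite_spaced_sets)
    moreover have "m choose k \<le> card ?A" "m choose j \<le> card ?B"
      using Suc.IH unfolding p_def by blast+
    ultimately show ?thesis
      by (simp add: k)
  qed
qed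

section \<open>Lower bound on the size of \<open>S_hat\<close> by rotation\<close>

text \<open>Rotation of the circle \<open>{0..<K}\<close>, relabelled as \<open>{1..K}\<close>, taking \<open>0\<close> to \<open>a\<close>.\<close>

definition rotate_to :: "nat \<Rightarrow> nat \<Rightarrow> nat \<Rightarrow> nat" where
  "rotate_to K a x = (if x + a \<le> K then x + a else x + a - K)"

lemma rotate_to_inj_on: "a \<in> {1..K} \<Longrightarrow> inj_on (rotate_to K a) {..<K}"
  by (auto simp: inj_on_def rotate_to_def split: if_splits)

lemma rotate_to_range: "a \<in> {1..K} \<Longrightarrow> x < K \<Longrightarrow> rotate_to K a x \<in> {1..K}"
  by (auto simp: rotate_to_def)

text \<open>The last two assumptions bound both arcs between \<open>x\<close> and \<open>y\<close>.
  The distance after relabelling is \<open>y - x\<close>, or \<open>K - (y - x)\<close> when only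
  \<open>y\<close> wraps around.\<close>

lemma rotate_to_spaced:
  assumes "a \<in> {1..K}" "x < K" "y < K" "x + L \<le> y" "y + L \<le> K + x"
  shows "\<bar>int (rotate_to K a x) - int (rotate_to K a y)\<bar> \<ge> int L"
    and "int K - \<bar>int (rotate_to K a x) - int (rotate_to K a y)\<bar> \<ge> int L"
  using assms by (auto simp: rotate_to_def)

lemma finite_S_hat: "finite (S_hat K L w)"
  by (rule finite_subset[of _ "Pow {1..K}"]) (auto simp: S_hat_def)

text \<open>Cutting the circle at \<open>a\<close> and removing the block of \<open>a\<close> leaves
  an interval of length \<open>K - L\<close> for the other \<open>k\<close> blocks.\<close>

lemma card_spaced_sets_le_S_hat:
  assumes "L > 0" "L \<le> K" "a \<in> {1..K}"
  shows "card (spaced_sets L k (K - L)) \<le> card {s \<in> S_hat K L (Suc k). a \<in> s}"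
proof (rule card_inj_on_le)
  \<comment> \<open>The shift by \<open>L\<close> makes room for the block of \<open>0\<close>, the
    point that the rotation sends to \<open>a\<close>.\<close>
  let ?base = "\<lambda>t. insert 0 ((\<lambda>x. x + L) ` t)"
  let ?f = "\<lambda>t. rotate_to K a ` ?base t"
  have base: "?base t \<subseteq> {..<K}" if "t \<in> spaced_sets L k (K - L)" for t
    using that assms by (auto simp: spaced_sets_def)
  show "inj_on ?f (spaced_sets L k (K - L))"
  proof (rule inj_onI)
    fix t u assume tu: "t \<in> spaced_sets L k (K - L)" "u \<in> spaced_sets L k (K - L)" "?f t = ?f u"
    have "?base t = ?base u"
      using inj_on_image_eq_iff[OF rotate_to_inj_on[OF assms(3)] base[OF tu(1)] base[OF tu(2)]]
        tu(3) by simp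
    moreover have "0 \<notin> (\<lambda>x. x + L) ` v" for v
      using assms by auto
    ultimately have "(\<lambda>x. x + L) ` t = (\<lambda>x. x + L) ` u"
      by (metis insert_ident)
    then show "t = u"
      by (simp add: inj_image_eq_iff)
  qed
  show "?f ` spaced_sets L k (K - L) \<subseteq> {s \<in> S_hat K L (Suc k). a \<in> s}"
  proof (rule image_subsetI)
    fix t assume t: "t \<in> spaced_sets L k (K - L)"
    have "card (?base t) = Suc k"
      using t assms by (auto simp: spaced_sets_def card_image card_insert_if)
    then have card: "card (?f t) = Suc k"
      using card_image[OF inj_on_subset[OF rotate_to_inj_on[OF assms(3)] base[OF t]]] by simp
    have sub: "?f t \<subseteq> {1..K}"
      using rotate_to_range[OF assms(3)] base[OF t] by blast
    \<comment> \<open>The second bound is the gap across the cut: every block ends by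
      \<open>K\<close>, so \<open>y + L \<le> K\<close> already.\<close>
    have lin: "x + L \<le> y \<and> y + L \<le> K + x" if xy: "x \<in> ?base t" "y \<in> ?base t" "x < y" for x y
    proof -
      have t': "v + L \<le> K - L" "u \<in> t \<Longrightarrow> u < v \<Longrightarrow> u + L \<le> v" if "v \<in> t" for u v
        using t that by (simp_all add: spaced_sets_def)
      from xy obtain v where v: "v \<in> t" "y = v + L"
        by auto
      with xy consider "x = 0" | u where "u \<in> t" "x = u + L"
        by blast
      then show ?thesis
        using v t'[OF v(1)] xy(3) assms by cases auto
    qed
    have sep: "\<bar>int (rotate_to K a x) - int (rotate_to K a y)\<bar> \<ge> int L \<and>
        int K - \<bar>int (rotate_to K a x) - int (rotate_to K a y)\<bar> \<ge> int L"
      if xy: "x \<in> ?base t" "y \<in> ?base t" "x \<noteq> y" for x y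
    proof -
      have K: "x < K" "y < K"
        using base[OF t] xy by auto
      consider "x < y" | "y < x"
        using xy by linarith
      then show ?thesis
      proof cases
        case 1
        then show ?thesis
          using rotate_to_spaced[OF assms(3) K] lin[OF xy(1,2)] by simp
      next
        case 2
        then show ?thesis
          using rotate_to_spaced[OF assms(3) K(2,1)] lin[OF xy(2,1)]
          by (simp add: abs_minus_commute)
      qed
    qed
    have "\<forall>b\<in>?f t. \<forall>c\<in>?f t. b \<noteq> c \<longrightarrow>
        \<bar>int b - int c\<bar> \<ge> int L \<and> int K - \<bar>int b - int c\<bar> \<ge> int L"
    proof (intro ballI impI)
      fix b c assume "b \<in> ?f t" "c \<in> ?f t" "b \<noteq> c"
      then obtain x y where "x \<in> ?base t" "y \<in> ?base t" "b = rotate_to K a x" "c = rotate_to K a y"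
        by blast
      with sep[of x y] \<open>b \<noteq> c\<close> show "\<bar>int b - int c\<bar> \<ge> int L \<and> int K - \<bar>int b - int c\<bar> \<ge> int L"
        by blast
    qed
    moreover have "a \<in> ?f t"
      using assms by (simp add: rotate_to_def)
    ultimately show "?f t \<in> {s \<in> S_hat K L (Suc k). a \<in> s}"
      using card sub unfolding S_hat_def by blast
  qed
  show "finite {s \<in> S_hat K L (Suc k). a \<in> s}"
    using finite_S_hat by simp
qed

text \<open>With \<open>w = Suc k\<close> this is the lower half of the known formula for
  \<open>card (S_hat K L w)\<close>.\<close>

lemma card_S_hat_ge:
  assumes "L > 0" "K = Suc k * L + D"
  shows "K * ((D + k) choose k) \<le> Suc k * card (S_hat K L (Suc k))"
proof -
  have LK: "L \<le> K"
    using assms by simp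
  \<comment> \<open>Without the block of \<open>a\<close> there remain \<open>k\<close> blocks and
    \<open>D\<close> free cells, hence \<open>D + k\<close> cells after contraction.\<close>
  have KL: "K - L = (D + k) + k * (L - 1)"
    using assms by (cases L) auto
  have "K * ((D + k) choose k) = (\<Sum>a\<in>{1..K}. (D + k) choose k)"
    by simp
  also have "\<dots> \<le> (\<Sum>a\<in>{1..K}. card {s \<in> S_hat K L (Suc k). a \<in> s})"
    using binomial_le_card_spaced_sets[OF assms(1), of "D + k" k]
      card_spaced_sets_le_S_hat[OF assms(1) LK, of _ k] unfolding KL
    by (intro sum_mono) (meson le_trans)
  also have "\<dots> = Suc k * card (S_hat K L (Suc k))"
  proof (rule sum_multicount)
    show "\<forall>s\<in>S_hat K L (Suc k). card {a \<in> {1..K}. a \<in> s} = Suc k"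
    proof
      fix s assume "s \<in> S_hat K L (Suc k)"
      then have "{a \<in> {1..K}. a \<in> s} = s" "card s = Suc k"
        by (auto simp: S_hat_def)
      then show "card {a \<in> {1..K}. a \<in> s} = Suc k"
        by simp
    qed
  qed (simp_all add: finite_S_hat)
  finally show ?thesis .
qed

section \<open>Comparing compositions with \<open>S_hat\<close>\<close>

lemma card_weak_compositions:
  "card (weak_compositions (Suc w) (int n)) = (n + w) choose w"
proof -
  have "weak_compositions (Suc w) (int n) = {l. length l = Suc w \<and> sum_list l = n}"
    by (simp add: weak_compositions_def)
  then have "card (weak_compositions (Suc w) (int n)) = (n + w) choose n"
    using card_length_sum_list[of "Suc w" n] by simp
  then show ?thesis
    using binomial_symmetric[of n "n + w"] by simp
qed

lemma card_weak_compositions_le_S_hat: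
  assumes "L > 0" "w > 0" "K = w * L + D" "D > 0"
  shows "K * card (weak_compositions (w + 1) (int D - 1)) \<le> D * card (S_hat K L w)"
proof -
  obtain k where k: "w = Suc k"
    using assms by (cases w) auto
  obtain d where d: "D = Suc d"
    using assms by (cases D) auto
  let ?B = "weak_compositions (w + 1) (int D - 1)"
  have "card ?B = (D + k) choose w"
    using card_weak_compositions[of w d] by (simp add: d k)
  \<comment> \<open>Both sides equal \<open>(D + k) * ((D + k - 1) choose k)\<close> by the two
    absorption identities.\<close>
  then have B: "w * card ?B = D * ((D + k) choose k)"
    using binomial_absorb_comp[of "D + k" k] binomial_absorption[of k "D + k"]
    by (simp add: k)
  have "w * (K * card ?B) = D * (K * ((D + k) choose k))"
    using B by (metis mult.left_commute)
  also have "\<dots> \<le> D * (w * card (S_hat K L w))"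
    using card_S_hat_ge[of L K k D] assms unfolding k by (intro mult_left_mono) simp_all
  also have "\<dots> = w * (D * card (S_hat K L w))"
    by (rule mult.left_commute)
  finally show ?thesis
    using assms by simp
qed

section \<open>Bounds on the rates\<close>

text \<open>The sum is at most \<open>c\<close> times the number of compositions, and the key fact
  replaces the ratio of the two cardinalities by \<open>D / K\<close>. The variable \<open>x\<close>
  stands for the maximum component.\<close>

lemma R_new_le:
  fixes c :: real
  assumes "L > 0" "w > 0" "K = w * L + D" "0 \<le> c"
    and bound: "\<And>x. D > 0 \<Longrightarrow> 0 \<le> x \<Longrightarrow>
      real_of_int (min (2 * int D + int w - 1 - x) (int K)) \<le> c"
  shows "R_new K L w \<le> c * real D / (real K * (real w + 1))"
proof (cases "D = 0")
  case True
  \<comment> \<open>The target is \<open>-1\<close>, so the sum is empty and both sides of the claim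
    are \<open>0\<close>.\<close>
  then have "weak_compositions (w + 1) (int K - int w * int L - 1) = {}"
    using assms by (auto simp: weak_compositions_def)
  then show ?thesis
    using True by (simp add: R_new_def)
next
  case False
  define B where "B = weak_compositions (w + 1) (int D - 1)"
  define S where "S = S_hat K L w"
  have D: "int K - int w * int L = int D"
    using assms by simp
  have le: "real K * real (card B) \<le> real D * real (card S)"
    using card_weak_compositions_le_S_hat[OF assms(1-3)] False unfolding B_def S_def
    by (metis of_nat_mult of_nat_le_iff neq0_conv)
  have K: "K > 0"
    using assms by simp
  obtain d where d: "D = Suc d"
    using False by (cases D) auto
  have "card B > 0"
    using card_weak_compositions[of w d] by (simp add: B_def d)
  then have "0 < real K * real (card B)"
    using K by simp
  \<comment> \<open>Positivity of \<open>card S\<close> comes from the key fact itself, and allows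
    \<open>card S\<close> to be cancelled at the end.\<close>
  with le have S: "real (card S) > 0"
    by (cases "card S = 0") auto
  have "(\<Sum>b\<in>B. real_of_int (min (2 * int D + int w - 1 - int (max_component b)) (int K)))
      \<le> real (card B) * c"
    using bound False by (intro sum_bounded_above) simp
  also have "\<dots> \<le> real D * real (card S) / real K * c"
    using le K assms(4) by (intro mult_right_mono) (simp_all add: field_simps)
  finally have "R_new K L w \<le> real D * real (card S) / real K * c / (real (card S) * (real w + 1))"
    unfolding R_new_def D B_def[symmetric] S_def[symmetric] by (intro divide_right_mono) simp_all
  also have "\<dots> = c * real D / (real K * (real w + 1))"
    using S K by simp
  finally show ?thesis .
qed

theorem corollary7:
  fixes N K L w :: nat and M :: real
  assumes "N > 0" and "K > 0" and "L > 0" and "L \<le> K"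
    and "1 \<le> w" and "int w \<le> \<lfloor>real K / real L\<rfloor>"
    and "M = real w * real N / real K"
  shows "R_new K L w \<le> R_HKD K L w \<and> R_new K L w \<le> R_RK N K L M"
proof -
  have "real w \<le> real K / real L"
    using assms(6) by (simp add: le_floor_iff)
  then have "real (w * L) \<le> real K"
    using assms(3) by (simp add: field_simps)
  then obtain D where D: "K = w * L + D"
    using le_Suc_ex by (metis of_nat_le_iff)
  then have real_D: "real K - real w * real L = real D"
    by simp
  have w: "w > 0"
    using assms(5) by simp
  have "R_new K L w \<le> real K * real D / (real K * (real w + 1))"
    using assms(3) w D by (rule R_new_le) simp_all
  also have "\<dots> = R_HKD K L w"
    using assms(2) unfolding R_HKD_def real_D by (simp add: add.commute)
  finally have HKD: "R_new K L w \<le> R_HKD K L w" .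
  have "R_new K L w \<le> (real D * (real w + 1)) * real D / (real K * (real w + 1))"
    using assms(3) w D
  proof (rule R_new_le)
    fix x :: int assume "D > 0" "0 \<le> x"
    \<comment> \<open>This product is \<open>D * (w + 1) - (2 * D + w - 1)\<close>, the slack in the
      required bound.\<close>
    have "0 \<le> (int D - 1) * (int w - 1)"
      using \<open>D > 0\<close> w by simp
    then have "min (2 * int D + int w - 1 - x) (int K) \<le> int D * (int w + 1)"
      using \<open>0 \<le> x\<close> by (simp add: algebra_simps)
    then have "real_of_int (min (2 * int D + int w - 1 - x) (int K)) \<le> real_of_int (int D * (int w + 1))"
      by (rule of_int_le_iff[THEN iffD2])
    then show "real_of_int (min (2 * int D + int w - 1 - x) (int K)) \<le> real D * (real w + 1)"
      by simp
  qed simp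
  also have "\<dots> = real D * real D / real K"
  proof -
    have "real w + 1 \<noteq> 0"
      by linarith
    then show ?thesis
      using assms(2) by simp
  qed
  also have "\<dots> = R_RK N K L M"
  proof -
    \<comment> \<open>Substituting \<open>M\<close> gives
      \<open>L * M / N = w * L / K\<close>.\<close>
    have "1 - real L * M / real N = real D / real K"
      using assms(1,2) unfolding real_D[symmetric] assms(7) by (simp add: diff_divide_distrib)
    then show ?thesis
      using assms(2) by (simp add: R_RK_def power2_eq_square)
  qed
  finally show ?thesis
    using HKD by blast
qed

end
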